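(* Let $(\mathbf A_n)_{n\in\mathbb N}$ be an elementarily convergent sequence of base structures and $(\mathbf G_n)_{n\in\mathbb N}$ an elementarily convergent sequence of gadgets. Then the sequence $(\mathbf A_n*\mathbf G_n)_{n\in\mathbb N}$ is elementarily convergent, and \[ \operatorname{el-lim}(\mathbf A_n*\mathbf G_n)\equiv(\operatorname{el-lim}\mathbf A_n)*(\operatorname{el-lim}\mathbf G_n), \] where $\operatorname{el-lim}$ denotes any choice of an elementary limit of the respective sequence and $\equiv$ denotes elementary equivalence.
   Context: Fix a purely relational first-order language $L$ (with equality, all arities finite and positive) and a relation symbol $R\notin L$ of arity $\mathrm{ar}(R)\ge 1$. Structures are nonempty and of arbitrary cardinality; $V(\mathbf A)$ is the universe of $\mathbf A$. Base structures and gadgets. $L_R=L\cup\{R\}$; a base structure is an $L_R$-structure. $L_G$ is $L$ extended by constants $z_1,\dots,z_{\mathrm{ar}(R)}$; a gadget is an $L_G$-structure $\mathbf G$ in which the vertices $z_i^{\mathbf G}$ (the roots) are pairwise distinct. Gadget construction. For a base structure $\mathbf A$ and a gadget $\mathbf G$, $\mathbf A*\mathbf G$ is the $L$-structure with universe $\big(V(\mathbf A)\sqcup(R^{\mathbf A}\times V(\mathbf G))\big)/\!\sim$, where $\sim$ is the equivalence generated by $e_i\sim(\boldsymbol e,z_i^{\mathbf G})$ for $\boldsymbol e\in R^{\mathbf A}$, $i\in\{1,\dots,\mathrm{ar}(R)\}$. For $S\in L$ of arity $s$, $S^{\mathbf A*\mathbf G}=\{([a_1],\dots,[a_s]):(a_1,\dots,a_s)\in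 S^{\mathbf A}\}\cup\{([(\boldsymbol e,v_1)],\dots,[(\boldsymbol e,v_s)]):\boldsymbol e\in R^{\mathbf A},(v_1,\dots,v_s)\in S^{\mathbf G}\}$. Elementary convergence. A sequence of structures in a fixed language is elementarily convergent if for every sentence $\phi$ either all but finitely many members satisfy $\phi$, or all but finitely many satisfy $\neg\phi$. An elementary limit of such a sequence is any structure $\mathbf M$ (of arbitrary cardinality) in the same language such that $\mathbf M\models\phi$ iff all but finitely many members of the sequence satisfy $\phi$, for every sentence $\phi$; it exists and is unique up to elementary equivalence. *)

theory Defs
  imports Main
begin

text \<open>
  Constant symbols are named by natural numbers. The arity function is total on the type of
  relation symbols; only its values on the relation symbols of the language matter.
\<close>

record 'r language =
  rel_syms :: "'r set"
  arity :: "'r \<Rightarrow> nat"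
  const_syms :: "nat set"

datatype tm = Var nat | Cst nat

datatype 'r fm =
    Equ tm tm
  | Rel 'r "tm list"
  | Neg "'r fm"
  | Conj "'r fm" "'r fm"
  | Exi nat "'r fm"

primrec wf_tm :: "'r language \<Rightarrow> tm \<Rightarrow> bool" where
  "wf_tm \<L> (Var x) \<longleftrightarrow> True"
| "wf_tm \<L> (Cst c) \<longleftrightarrow> c \<in> const_syms \<L>"

primrec wf_fm :: "'r language \<Rightarrow> 'r fm \<Rightarrow> bool" where
  "wf_fm \<L> (Equ s t) \<longleftrightarrow> wf_tm \<L> s \<and> wf_tm \<L> t"
| "wf_fm \<L> (Rel S ts) \<longleftrightarrow>
     S \<in> rel_syms \<L> \<and> length ts = arity \<L> S \<and> (\<forall>t \<in> set ts. wf_tm \<L> t)"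
| "wf_fm \<L> (Neg \<phi>) \<longleftrightarrow> wf_fm \<L> \<phi>"
| "wf_fm \<L> (Conj \<phi> \<psi>) \<longleftrightarrow> wf_fm \<L> \<phi> \<and> wf_fm \<L> \<psi>"
| "wf_fm \<L> (Exi x \<phi>) \<longleftrightarrow> wf_fm \<L> \<phi>"

primrec tm_vars :: "tm \<Rightarrow> nat set" where
  "tm_vars (Var x) = {x}"
| "tm_vars (Cst c) = {}"

primrec free_vars :: "'r fm \<Rightarrow> nat set" where
  "free_vars (Equ s t) = tm_vars s \<union> tm_vars t"
| "free_vars (Rel S ts) = (\<Union>t \<in> set ts. tm_vars t)"
| "free_vars (Neg \<phi>) = free_vars \<phi>"
| "free_vars (Conj \<phi> \<psi>) = free_vars \<phi> \<union> free_vars \<psi>"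
| "free_vars (Exi x \<phi>) = free_vars \<phi> - {x}"

definition sentence :: "'r language \<Rightarrow> 'r fm \<Rightarrow> bool" where
  "sentence \<L> \<phi> \<longleftrightarrow> wf_fm \<L> \<phi> \<and> free_vars \<phi> = {}"

text \<open>
  Tuples are lists. Interpretations of symbols outside the language are unconstrained; no sentence
  of the language refers to them.
\<close>

record ('v, 'r) struct =
  univ :: "'v set"
  rel :: "'r \<Rightarrow> 'v list set"
  cst :: "nat \<Rightarrow> 'v"

definition structure_in :: "'r language \<Rightarrow> ('v, 'r) struct \<Rightarrow> bool" where
  "structure_in \<L> M \<longleftrightarrow>
     univ M \<noteq> {} \<and>
     (\<forall>S \<in> rel_syms \<L>. \<forall>xs \<in> rel M S. length xs = arity \<L> S \<and> set xs \<subseteq> univ M) \<and>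
     (\<forall>c \<in> const_syms \<L>. cst M c \<in> univ M)"

primrec tm_val :: "('v, 'r) struct \<Rightarrow> (nat \<Rightarrow> 'v) \<Rightarrow> tm \<Rightarrow> 'v" where
  "tm_val M \<sigma> (Var x) = \<sigma> x"
| "tm_val M \<sigma> (Cst c) = cst M c"

primrec sat :: "('v, 'r) struct \<Rightarrow> (nat \<Rightarrow> 'v) \<Rightarrow> 'r fm \<Rightarrow> bool" where
  "sat M \<sigma> (Equ s t) \<longleftrightarrow> tm_val M \<sigma> s = tm_val M \<sigma> t"
| "sat M \<sigma> (Rel S ts) \<longleftrightarrow> map (tm_val M \<sigma>) ts \<in> rel M S"
| "sat M \<sigma> (Neg \<phi>) \<longleftrightarrow> \<not> sat M \<sigma> \<phi>"
| "sat M \<sigma> (Conj \<phi> \<psi>) \<longleftrightarrow> sat M \<sigma> \<phi> \<and> sat M \<sigma> \<psi>"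
| "sat M \<sigma> (Exi x \<phi>) \<longleftrightarrow> (\<exists>a \<in> univ M. sat M (\<sigma>(x := a)) \<phi>)"

text \<open>
  For sentences and nonempty universes the choice of the assignment is immaterial.
\<close>

definition models :: "('v, 'r) struct \<Rightarrow> 'r fm \<Rightarrow> bool" (infix \<open>\<Turnstile>\<close> 50) where
  "M \<Turnstile> \<phi> \<longleftrightarrow> (\<forall>\<sigma>. range \<sigma> \<subseteq> univ M \<longrightarrow> sat M \<sigma> \<phi>)"

definition elem_equiv :: "'r language \<Rightarrow> ('v, 'r) struct \<Rightarrow> ('w, 'r) struct \<Rightarrow> bool" where
  "elem_equiv \<L> M N \<longleftrightarrow> (\<forall>\<phi>. sentence \<L> \<phi> \<longrightarrow> (M \<Turnstile> \<phi> \<longleftrightarrow> N \<Turnstile> \<phi>))"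

definition elem_convergent :: "'r language \<Rightarrow> (nat \<Rightarrow> ('v, 'r) struct) \<Rightarrow> bool" where
  "elem_convergent \<L> M \<longleftrightarrow>
     (\<forall>n. structure_in \<L> (M n)) \<and>
     (\<forall>\<phi>. sentence \<L> \<phi> \<longrightarrow> (\<forall>\<^sub>\<infinity>n. M n \<Turnstile> \<phi>) \<or> (\<forall>\<^sub>\<infinity>n. M n \<Turnstile> Neg \<phi>))"

definition elem_limit ::
    "'r language \<Rightarrow> (nat \<Rightarrow> ('v, 'r) struct) \<Rightarrow> ('w, 'r) struct \<Rightarrow> bool" where
  "elem_limit \<L> M N \<longleftrightarrow>
     structure_in \<L> N \<and>
     (\<forall>\<phi>. sentence \<L> \<phi> \<longrightarrow> (N \<Turnstile> \<phi> \<longleftrightarrow> (\<forall>\<^sub>\<infinity>n. M n \<Turnstile> \<phi>)))"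

text \<open>
  Below, \<open>L\<close> is the set of relation symbols of the purely relational language, \<open>ar\<close> gives the
  arities of these symbols and of \<open>R\<close>. Roots are indexed from 0: the root \<open>z_i\<close> is the constant
  symbol \<open>i - 1\<close>, in accordance with list indexing, where \<open>e_i\<close> is \<open>e ! (i - 1)\<close>.
\<close>

definition relational_lang :: "'r set \<Rightarrow> ('r \<Rightarrow> nat) \<Rightarrow> 'r language" where
  "relational_lang L ar = \<lparr>rel_syms = L, arity = ar, const_syms = {}\<rparr>"

definition base_lang :: "'r set \<Rightarrow> ('r \<Rightarrow> nat) \<Rightarrow> 'r \<Rightarrow> 'r language" where
  "base_lang L ar R = \<lparr>rel_syms = L \<union> {R}, arity = ar, const_syms = {}\<rparr>"

definition gadget_lang :: "'r set \<Rightarrow> ('r \<Rightarrow> nat) \<Rightarrow> 'r \<Rightarrow> 'r language" where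
  "gadget_lang L ar R = \<lparr>rel_syms = L, arity = ar, const_syms = {..<ar R}\<rparr>"

definition base_structure ::
    "'r set \<Rightarrow> ('r \<Rightarrow> nat) \<Rightarrow> 'r \<Rightarrow> ('a, 'r) struct \<Rightarrow> bool" where
  "base_structure L ar R A \<longleftrightarrow> structure_in (base_lang L ar R) A"

definition gadget :: "'r set \<Rightarrow> ('r \<Rightarrow> nat) \<Rightarrow> 'r \<Rightarrow> ('g, 'r) struct \<Rightarrow> bool" where
  "gadget L ar R G \<longleftrightarrow> structure_in (gadget_lang L ar R) G \<and> inj_on (cst G) {..<ar R}"

inductive root_glue ::
    "('r \<Rightarrow> nat) \<Rightarrow> 'r \<Rightarrow> ('a, 'r) struct \<Rightarrow> ('g, 'r) struct \<Rightarrow>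
     'a + 'a list \<times> 'g \<Rightarrow> 'a + 'a list \<times> 'g \<Rightarrow> bool"
  for ar R A G where
  "e \<in> rel A R \<Longrightarrow> i < ar R \<Longrightarrow> root_glue ar R A G (Inl (e ! i)) (Inr (e, cst G i))"

definition glue_equiv ::
    "('r \<Rightarrow> nat) \<Rightarrow> 'r \<Rightarrow> ('a, 'r) struct \<Rightarrow> ('g, 'r) struct \<Rightarrow>
     (('a + 'a list \<times> 'g) \<times> ('a + 'a list \<times> 'g)) set" where
  "glue_equiv ar R A G = {(x, y). equivclp (root_glue ar R A G) x y}"

definition glue_class ::
    "('r \<Rightarrow> nat) \<Rightarrow> 'r \<Rightarrow> ('a, 'r) struct \<Rightarrow> ('g, 'r) struct \<Rightarrow>
     'a + 'a list \<times> 'g \<Rightarrow> ('a + 'a list \<times> 'g) set" where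
  "glue_class ar R A G x = glue_equiv ar R A G `` {x}"

text \<open>
  The result is a structure in a language without constants, so its field \<open>cst\<close> is arbitrary.
\<close>

definition gadget_construction ::
    "('r \<Rightarrow> nat) \<Rightarrow> 'r \<Rightarrow> ('a, 'r) struct \<Rightarrow> ('g, 'r) struct \<Rightarrow>
     (('a + 'a list \<times> 'g) set, 'r) struct" where
  "gadget_construction ar R A G =
     \<lparr>univ = (univ A <+> (rel A R \<times> univ G)) // glue_equiv ar R A G,
      rel = (\<lambda>S.
        {map (\<lambda>a. glue_class ar R A G (Inl a)) as | as. as \<in> rel A S} \<union>
        {map (\<lambda>v. glue_class ar R A G (Inr (e, v))) vs | e vs. e \<in> rel A R \<and> vs \<in> rel G S}),
      cst = (\<lambda>_. undefined)\<rparr>"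

lemma structure_in_gadget_construction:
  assumes "base_structure L ar R A" and "gadget L ar R G"
  shows "structure_in (relational_lang L ar) (gadget_construction ar R A G)"
  using assms
  unfolding structure_in_def base_structure_def gadget_def gadget_construction_def
    relational_lang_def base_lang_def gadget_lang_def glue_class_def
  by (fastforce simp: quotient_def)

end

theory Submission
  imports Defs
begin

text \<open>
  The structure \<open>A * G\<close> is interpretable in the two-sorted structure \<open>(A, G)\<close>: its elements are
  represented by vertices \<open>a\<close> of \<open>A\<close> and by pairs \<open>(e, v)\<close>, and since the roots are distinct, two
  different representatives are glued iff both are roots anchored at the same vertex of \<open>A\<close>, which
  is a first-order condition. A two-sorted formula is equivalent to a disjunction of conjunctions
  \<open>\<alpha> \<and> \<beta>\<close> with \<open>\<alpha>\<close> about \<open>A\<close> and \<open>\<beta>\<close> about \<open>G\<close>, because a quantifier over one sort passes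
  through the formulas about the other. So the truth of a sentence in \<open>A * G\<close> is a fixed
  finite Boolean combination of truths of sentences in \<open>A\<close> and in \<open>G\<close>, and these converge.
\<close>

section \<open>Sentences\<close>

lemma sat_cong_free_vars:
  assumes "\<And>x. x \<in> free_vars \<phi> \<Longrightarrow> \<sigma> x = \<sigma>' x"
  shows "sat M \<sigma> \<phi> \<longleftrightarrow> sat M \<sigma>' \<phi>"
  using assms
proof (induction \<phi> arbitrary: \<sigma> \<sigma>')
  have tm: "tm_val M \<sigma> t = tm_val M \<sigma>' t" if "\<And>x. x \<in> tm_vars t \<Longrightarrow> \<sigma> x = \<sigma>' x" for \<sigma> \<sigma>' t
    using that by (cases t) auto
  {
    case (Equ s t)
    then show ?case using tm[of s \<sigma> \<sigma>'] tm[of t \<sigma> \<sigma>'] by simp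
  next
    case (Rel S ts)
    have "map (tm_val M \<sigma>) ts = map (tm_val M \<sigma>') ts"
      using Rel by (intro map_cong refl tm) auto
    then show ?case by (simp only: sat.simps)
  next
    case (Neg \<phi>)
    then show ?case by (metis free_vars.simps(3) sat.simps(3))
  next
    case (Conj \<phi> \<psi>)
    have "sat M \<sigma> \<phi> = sat M \<sigma>' \<phi>" "sat M \<sigma> \<psi> = sat M \<sigma>' \<psi>"
      by (intro Conj; simp add: Conj.prems)+
    then show ?case by simp
  next
    case (Exi x \<phi>)
    have "sat M (\<sigma>(x := a)) \<phi> = sat M (\<sigma>'(x := a)) \<phi>" for a
      using Exi.prems by (intro Exi.IH) auto
    then show ?case by simp
  }
qed

lemma models_iff_sat:
  assumes "free_vars \<phi> = {}" and "range \<sigma> \<subseteq> univ M"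
  shows "M \<Turnstile> \<phi> \<longleftrightarrow> sat M \<sigma> \<phi>"
proof -
  have "sat M \<sigma>' \<phi> \<longleftrightarrow> sat M \<sigma> \<phi>" for \<sigma>'
    by (rule sat_cong_free_vars) (simp add: assms(1))
  with assms(2) show ?thesis by (auto simp: models_def)
qed

text \<open>In an empty universe no assignment has its range inside it, so both sides of a negation
  would hold vacuously. A point of the universe gives a constant assignment to test on.\<close>

lemma models_Neg:
  assumes "free_vars \<phi> = {}" and "univ M \<noteq> {}"
  shows "M \<Turnstile> Neg \<phi> \<longleftrightarrow> \<not> M \<Turnstile> \<phi>"
proof -
  from assms(2) obtain a where "a \<in> univ M" by blast
  then have r: "range (\<lambda>_. a) \<subseteq> univ M" by auto
  show ?thesis
    using models_iff_sat[OF assms(1) r] models_iff_sat[of "Neg \<phi>", OF _ r] assms(1) by simp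
qed

text \<open>Being closed and free of relation and constant symbols, this is a sentence of every
  language, so it can fill the idle side of a pair.\<close>

definition Tru :: "'r fm" where
  "Tru = Neg (Exi 0 (Neg (Equ (Var 0) (Var 0))))"

lemma Tru_simps [simp]: "sat M \<sigma> Tru" "free_vars Tru = {}" "wf_fm \<L> Tru"
  by (auto simp: Tru_def)

definition conjs :: "'r fm list \<Rightarrow> 'r fm" where
  "conjs \<phi>s = foldr Conj \<phi>s Tru"

lemma sat_conjs [simp]: "sat M \<sigma> (conjs \<phi>s) \<longleftrightarrow> (\<forall>\<phi> \<in> set \<phi>s. sat M \<sigma> \<phi>)"
  by (induction \<phi>s) (auto simp: conjs_def)

lemma wf_conjs [simp]: "wf_fm \<L> (conjs \<phi>s) \<longleftrightarrow> (\<forall>\<phi> \<in> set \<phi>s. wf_fm \<L> \<phi>)"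
  by (induction \<phi>s) (auto simp: conjs_def)

lemma free_vars_conjs [simp]: "free_vars (conjs \<phi>s) = (\<Union>\<phi> \<in> set \<phi>s. free_vars \<phi>)"
  by (induction \<phi>s) (auto simp: conjs_def)

section \<open>Two-sorted formulas in disjunctive normal form\<close>

text \<open>A pair is the conjunction of a formula about \<open>A\<close> and one about
  \<open>G\<close>, the list is a disjunction, and the empty list is falsity. The two sides number
  their variables independently.\<close>

type_synonym 'r dnf = "('r fm \<times> 'r fm) list"

definition sat2 ::
    "('a, 'r) struct \<Rightarrow> ('g, 'r) struct \<Rightarrow> (nat \<Rightarrow> 'a) \<Rightarrow> (nat \<Rightarrow> 'g) \<Rightarrow> 'r dnf \<Rightarrow> bool" where
  "sat2 A G \<sigma> \<tau> D \<longleftrightarrow> (\<exists>d \<in> set D. sat A \<sigma> (fst d) \<and> sat G \<tau> (snd d))"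

text \<open>The variables \<open>m\<close> of the first side and \<open>n\<close> of the second are
  the first fresh ones; with both bounds 0 the pairs consist of sentences.\<close>

definition wf2 :: "'r language \<Rightarrow> 'r language \<Rightarrow> nat \<Rightarrow> nat \<Rightarrow> 'r dnf \<Rightarrow> bool" where
  "wf2 \<L> \<L>' m n D \<longleftrightarrow> (\<forall>d \<in> set D.
     wf_fm \<L> (fst d) \<and> free_vars (fst d) \<subseteq> {..<m} \<and>
     wf_fm \<L>' (snd d) \<and> free_vars (snd d) \<subseteq> {..<n})"

definition base2 :: "'r fm \<Rightarrow> 'r dnf" where
  "base2 \<alpha> = [(\<alpha>, Tru)]"

definition gadget2 :: "'r fm \<Rightarrow> 'r dnf" where
  "gadget2 \<beta> = [(Tru, \<beta>)]"

definition conj2 :: "'r dnf \<Rightarrow> 'r dnf \<Rightarrow> 'r dnf" where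
  "conj2 D E = map (\<lambda>(d, e). (Conj (fst d) (fst e), Conj (snd d) (snd e))) (List.product D E)"

definition conjs2 :: "'r dnf list \<Rightarrow> 'r dnf" where
  "conjs2 Ds = foldr conj2 Ds (base2 Tru)"

text \<open>De Morgan: each pair becomes a disjunction of two negated components, and the
  conjunction of these is multiplied out again.\<close>

definition neg2 :: "'r dnf \<Rightarrow> 'r dnf" where
  "neg2 D = conjs2 (map (\<lambda>d. base2 (Neg (fst d)) @ gadget2 (Neg (snd d))) D)"

text \<open>An existential quantifier distributes over the disjunction and passes the conjunct about
  \<open>G\<close>, whose truth does not depend on the assignment in \<open>A\<close>.\<close>

definition exA :: "nat \<Rightarrow> 'r dnf \<Rightarrow> 'r dnf" where
  "exA x D = map (\<lambda>d. (Exi x (fst d), snd d)) D"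

definition exG :: "nat \<Rightarrow> 'r dnf \<Rightarrow> 'r dnf" where
  "exG x D = map (\<lambda>d. (fst d, Exi x (snd d))) D"

section \<open>Quantification over tuples\<close>

primrec exAs :: "nat \<Rightarrow> nat \<Rightarrow> 'r dnf \<Rightarrow> 'r dnf" where
  "exAs m 0 D = D"
| "exAs m (Suc k) D = exA m (exAs (Suc m) k D)"

primrec exGs :: "nat \<Rightarrow> nat \<Rightarrow> 'r dnf \<Rightarrow> 'r dnf" where
  "exGs m 0 D = D"
| "exGs m (Suc k) D = exG m (exGs (Suc m) k D)"

text \<open>The assignment reached once a block of quantifiers has chosen its witnesses.\<close>

primrec upds :: "(nat \<Rightarrow> 'v) \<Rightarrow> nat \<Rightarrow> 'v list \<Rightarrow> nat \<Rightarrow> 'v" where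
  "upds \<sigma> m [] = \<sigma>"
| "upds \<sigma> m (a # as) = upds (\<sigma>(m := a)) (Suc m) as"

lemma upds_less: "i < m \<Longrightarrow> upds \<sigma> m as i = \<sigma> i"
  by (induction as arbitrary: \<sigma> m) auto

text \<open>Used to evaluate atoms \<open>Rel S (map Var [m..<m + k])\<close>: reading back the
  block of variables returns the chosen tuple.\<close>

lemma map_upds_upt: "k = length as \<Longrightarrow> map (upds \<sigma> m as) [m..<m + k] = as"
proof (induction as arbitrary: \<sigma> m k)
  case (Cons a as)
  have "[m..<m + k] = m # [Suc m..<Suc m + length as]"
    using Cons.prems by (subst upt_conv_Cons) auto
  then show ?case using Cons.IH[of "length as" "\<sigma>(m := a)" "Suc m"] by (simp add: upds_less fun_upd_same del: upt.simps fun_upd_apply)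
qed simp

lemma upds_nth:
  assumes "i < length as"
  shows "upds \<sigma> m as (m + i) = as ! i"
proof -
  have "upds \<sigma> m as (m + i) = map (upds \<sigma> m as) [m..<m + length as] ! i"
    using assms by (simp only: nth_map_upt add_diff_cancel_left')
  also have "\<dots> = as ! i" by (simp only: map_upds_upt)
  finally show ?thesis .
qed

text \<open>The index set has the form of \<open>set [0..<s]\<close>, which is what the conjunctions
  in \<open>rel2\<close> produce.\<close>

lemma map_eq_map_iff:
  "map f xs = map g ys \<longleftrightarrow>
   length xs = length ys \<and> (\<forall>i \<in> {0..<length xs}. f (xs ! i) = g (ys ! i))"
  unfolding list_eq_iff_nth_eq[of "map f xs"] by (simp add: Ball_def cong: conj_cong)

section \<open>Semantics of the operations on normal forms\<close>

lemma sat2_append [simp]: "sat2 A G \<sigma> \<tau> (D @ E) \<longleftrightarrow> sat2 A G \<sigma> \<tau> D \<or> sat2 A G \<sigma> \<tau> E"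
  by (auto simp: sat2_def)

lemma sat2_base2 [simp]: "sat2 A G \<sigma> \<tau> (base2 \<alpha>) \<longleftrightarrow> sat A \<sigma> \<alpha>"
  by (auto simp: sat2_def base2_def)

lemma sat2_gadget2 [simp]: "sat2 A G \<sigma> \<tau> (gadget2 \<beta>) \<longleftrightarrow> sat G \<tau> \<beta>"
  by (auto simp: sat2_def gadget2_def)

lemma sat2_conj2 [simp]: "sat2 A G \<sigma> \<tau> (conj2 D E) \<longleftrightarrow> sat2 A G \<sigma> \<tau> D \<and> sat2 A G \<sigma> \<tau> E"
  unfolding sat2_def conj2_def by (simp add: Bex_def case_prod_beta) blast

lemma sat2_conjs2 [simp]: "sat2 A G \<sigma> \<tau> (conjs2 Ds) \<longleftrightarrow> (\<forall>D \<in> set Ds. sat2 A G \<sigma> \<tau> D)"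
  by (induction Ds) (auto simp: conjs2_def)

lemma sat2_neg2 [simp]: "sat2 A G \<sigma> \<tau> (neg2 D) \<longleftrightarrow> \<not> sat2 A G \<sigma> \<tau> D"
  unfolding neg2_def by (auto simp: sat2_def[of _ _ _ _ D])

lemma sat2_exA [simp]: "sat2 A G \<sigma> \<tau> (exA x D) \<longleftrightarrow> (\<exists>a \<in> univ A. sat2 A G (\<sigma>(x := a)) \<tau> D)"
  unfolding sat2_def exA_def by (simp add: Bex_def) blast

lemma sat2_exG [simp]: "sat2 A G \<sigma> \<tau> (exG x D) \<longleftrightarrow> (\<exists>v \<in> univ G. sat2 A G \<sigma> (\<tau>(x := v)) D)"
  unfolding sat2_def exG_def by (simp add: Bex_def) blast

text \<open>Peels one witness off a tuple, matching the successor step of \<open>exAs\<close> and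
  \<open>exGs\<close>.\<close>

lemma ex_list_Suc:
  "(\<exists>as. length as = Suc k \<and> set as \<subseteq> U \<and> P as) \<longleftrightarrow>
   (\<exists>a \<in> U. \<exists>as. length as = k \<and> set as \<subseteq> U \<and> P (a # as))"
proof
  assume "\<exists>as. length as = Suc k \<and> set as \<subseteq> U \<and> P as"
  then show "\<exists>a \<in> U. \<exists>as. length as = k \<and> set as \<subseteq> U \<and> P (a # as)"
    by (force simp: length_Suc_conv)
next
  assume "\<exists>a \<in> U. \<exists>as. length as = k \<and> set as \<subseteq> U \<and> P (a # as)"
  then obtain a as where "a \<in> U" "length as = k" "set as \<subseteq> U" "P (a # as)" by blast
  then show "\<exists>as. length as = Suc k \<and> set as \<subseteq> U \<and> P as"
    by (intro exI[of _ "a # as"]) auto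
qed

lemma sat2_exAs [simp]:
  "sat2 A G \<sigma> \<tau> (exAs m k D) \<longleftrightarrow>
   (\<exists>as. length as = k \<and> set as \<subseteq> univ A \<and> sat2 A G (upds \<sigma> m as) \<tau> D)"
  by (induction k arbitrary: m \<sigma>) (simp_all add: ex_list_Suc)

lemma sat2_exGs [simp]:
  "sat2 A G \<sigma> \<tau> (exGs m k D) \<longleftrightarrow>
   (\<exists>vs. length vs = k \<and> set vs \<subseteq> univ G \<and> sat2 A G \<sigma> (upds \<tau> m vs) D)"
  by (induction k arbitrary: m \<tau>) (simp_all add: ex_list_Suc)

section \<open>Well-formedness and free variables of normal forms\<close>

lemma wf2_append [simp]: "wf2 \<L> \<L>' m n (D @ E) \<longleftrightarrow> wf2 \<L> \<L>' m n D \<and> wf2 \<L> \<L>' m n E"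
  unfolding wf2_def set_append by blast

lemma wf2_base2 [simp]: "wf2 \<L> \<L>' m n (base2 \<alpha>) \<longleftrightarrow> wf_fm \<L> \<alpha> \<and> free_vars \<alpha> \<subseteq> {..<m}"
  by (auto simp: wf2_def base2_def)

lemma wf2_gadget2 [simp]: "wf2 \<L> \<L>' m n (gadget2 \<beta>) \<longleftrightarrow> wf_fm \<L>' \<beta> \<and> free_vars \<beta> \<subseteq> {..<n}"
  by (auto simp: wf2_def gadget2_def)

lemma wf2_conj2: "wf2 \<L> \<L>' m n D \<Longrightarrow> wf2 \<L> \<L>' m n E \<Longrightarrow> wf2 \<L> \<L>' m n (conj2 D E)"
  unfolding wf2_def conj2_def by (auto simp: subset_iff)

lemma wf2_conjs2: "(\<And>D. D \<in> set Ds \<Longrightarrow> wf2 \<L> \<L>' m n D) \<Longrightarrow> wf2 \<L> \<L>' m n (conjs2 Ds)"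
  by (induction Ds) (auto simp: conjs2_def wf2_conj2)

lemma wf2_neg2: "wf2 \<L> \<L>' m n D \<Longrightarrow> wf2 \<L> \<L>' m n (neg2 D)"
  unfolding neg2_def by (rule wf2_conjs2) (auto simp: wf2_def[of _ _ _ _ D])

text \<open>Only the topmost variable \<open>m\<close> gets bound, so the bound on the free
  variables drops by one.\<close>

lemma wf2_exA: "wf2 \<L> \<L>' (Suc m) n D \<Longrightarrow> wf2 \<L> \<L>' m n (exA m D)"
  unfolding wf2_def exA_def by (auto simp: subset_iff less_Suc_eq)

lemma wf2_exG: "wf2 \<L> \<L>' m (Suc n) D \<Longrightarrow> wf2 \<L> \<L>' m n (exG n D)"
  unfolding wf2_def exG_def by (auto simp: subset_iff less_Suc_eq)

lemma wf2_exAs: "wf2 \<L> \<L>' (m + k) n D \<Longrightarrow> wf2 \<L> \<L>' m n (exAs m k D)"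
  by (induction k arbitrary: m) (auto intro: wf2_exA)

lemma wf2_exGs: "wf2 \<L> \<L>' m (n + k) D \<Longrightarrow> wf2 \<L> \<L>' m n (exGs n k D)"
  by (induction k arbitrary: n) (auto intro: wf2_exG)

section \<open>The gluing relation\<close>

text \<open>The vertex of \<open>A\<close> to which a representative is glued: a vertex is its own
  anchor, a root of a gadget copy is anchored at the matching entry of \<open>e\<close>, and other
  pairs have no anchor.\<close>

definition anchored ::
    "('r \<Rightarrow> nat) \<Rightarrow> 'r \<Rightarrow> ('a, 'r) struct \<Rightarrow> ('g, 'r) struct \<Rightarrow> 'a + 'a list \<times> 'g \<Rightarrow> 'a \<Rightarrow> bool"
where
  "anchored ar R A G x a \<longleftrightarrow>
     x = Inl a \<or> (\<exists>e i. e \<in> rel A R \<and> i < ar R \<and> a = e ! i \<and> x = Inr (e, cst G i))"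

lemma anchored_simps [simp]:
  "anchored ar R A G (Inl b) a \<longleftrightarrow> b = a"
  "anchored ar R A G (Inr (e, v)) a \<longleftrightarrow> e \<in> rel A R \<and> (\<exists>i<ar R. a = e ! i \<and> v = cst G i)"
  by (auto simp: anchored_def)

text \<open>The right-hand side contains the generating relation and is transitive because a
  representative has at most one anchor. Conversely, elements with a common anchor are both glued to
  it.\<close>

lemma equivclp_root_glue_iff:
  assumes "inj_on (cst G) {..<ar R}"
  shows "equivclp (root_glue ar R A G) x y \<longleftrightarrow>
    x = y \<or> (\<exists>a. anchored ar R A G x a \<and> anchored ar R A G y a)"
proof
  \<comment> \<open>Distinctness of the roots enters here: the pair \<open>(e, cst G i)\<close>
    determines \<open>i\<close>, and hence its anchor \<open>e ! i\<close>.\<close>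
  have functional: "a = b" if "anchored ar R A G x a" "anchored ar R A G x b" for x a b
    using that assms unfolding anchored_def inj_on_def by auto
  assume "equivclp (root_glue ar R A G) x y"
  then show "x = y \<or> (\<exists>a. anchored ar R A G x a \<and> anchored ar R A G y a)"
  proof (induction rule: equivclp_induct)
    case (step y z)
    then have "\<exists>a. anchored ar R A G y a \<and> anchored ar R A G z a"
      by (auto simp: root_glue.simps anchored_def)
    with step.IH show ?case using functional by blast
  qed simp
next
  have to_anchor: "equivclp (root_glue ar R A G) (Inl a) x" if "anchored ar R A G x a" for x a
    using that by (auto simp: anchored_def intro: root_glue.intros r_into_equivclp)
  assume "x = y \<or> (\<exists>a. anchored ar R A G x a \<and> anchored ar R A G y a)"
  then show "equivclp (root_glue ar R A G) x y"
    by (metis to_anchor equivclp_refl equivclp_sym equivclp_trans)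
qed

text \<open>The gluing is an equivalence on the whole type, so classes can be compared without
  membership conditions.\<close>

lemma glue_class_eq_iff:
  assumes "inj_on (cst G) {..<ar R}"
  shows "glue_class ar R A G x = glue_class ar R A G y \<longleftrightarrow>
    x = y \<or> (\<exists>a. anchored ar R A G x a \<and> anchored ar R A G y a)"
proof -
  have "equiv UNIV (glue_equiv ar R A G)"
    unfolding glue_equiv_def
    by (intro equivI reflI symI transI)
      (auto intro: equivclp_sym equivclp_trans simp: refl_on_def)
  then show ?thesis
    unfolding glue_class_def
    by (simp add: eq_equiv_class_iff) (simp add: glue_equiv_def equivclp_root_glue_iff[of G ar R, OF assms])
qed

section \<open>Translation\<close>

text \<open>
  A symbolic representative is evaluated under assignments of its variables in \<open>A\<close> and in \<open>G\<close>; it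
  names an element of \<open>A * G\<close>.
\<close>

type_synonym srep = "nat + nat list \<times> nat"

definition srep_val :: "(nat \<Rightarrow> 'a) \<Rightarrow> (nat \<Rightarrow> 'g) \<Rightarrow> srep \<Rightarrow> 'a + 'a list \<times> 'g" where
  "srep_val \<sigma> \<tau> = map_sum \<sigma> (map_prod (map \<sigma>) \<tau>)"

lemma srep_val_simps [simp]:
  "srep_val \<sigma> \<tau> (Inl y) = Inl (\<sigma> y)"
  "srep_val \<sigma> \<tau> (Inr (es, v)) = Inr (map \<sigma> es, \<tau> v)"
  by (simp_all add: srep_val_def)

text \<open>Here \<open>r\<close> is the arity of \<open>R\<close>, and \<open>m\<close> and
  \<open>n\<close> are bounds as in \<open>wf2\<close>.\<close>

fun srep_ok :: "nat \<Rightarrow> nat \<Rightarrow> nat \<Rightarrow> srep \<Rightarrow> bool" where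
  "srep_ok r m n (Inl y) \<longleftrightarrow> y < m"
| "srep_ok r m n (Inr (es, v)) \<longleftrightarrow> length es = r \<and> set es \<subseteq> {..<m} \<and> v < n"

lemma srep_ok_mono: "srep_ok r m n p \<Longrightarrow> m \<le> m' \<Longrightarrow> n \<le> n' \<Longrightarrow> srep_ok r m' n' p"
  by (induction r m n p rule: srep_ok.induct) auto

text \<open>Lets fresh variables receive values without moving the representatives chosen
  before.\<close>

lemma srep_val_cong:
  "srep_ok r m n p \<Longrightarrow> (\<And>i. i < m \<Longrightarrow> \<sigma> i = \<sigma>' i) \<Longrightarrow> (\<And>i. i < n \<Longrightarrow> \<tau> i = \<tau>' i) \<Longrightarrow>
   srep_val \<sigma> \<tau> p = srep_val \<sigma>' \<tau>' p"
  by (induction r m n p rule: srep_ok.induct) auto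

text \<open>Expresses \<open>glue_class_eq_iff\<close> case by case. In the last case the first pair
  says that the representatives coincide, and the others run through the positions \<open>i\<close>,
  \<open>j\<close> at which both are roots with the same anchor.\<close>

fun eq2 :: "nat \<Rightarrow> srep \<Rightarrow> srep \<Rightarrow> 'r dnf" where
  "eq2 r (Inl y) (Inl z) = base2 (Equ (Var y) (Var z))"
| "eq2 r (Inl y) (Inr (es, v)) =
     map (\<lambda>i. (Equ (Var y) (Var (es ! i)), Equ (Var v) (Cst i))) [0..<r]"
| "eq2 r (Inr (es, v)) (Inl y) =
     map (\<lambda>i. (Equ (Var y) (Var (es ! i)), Equ (Var v) (Cst i))) [0..<r]"
| "eq2 r (Inr (es, v)) (Inr (es', v')) =
     (conjs (map (\<lambda>i. Equ (Var (es ! i)) (Var (es' ! i))) [0..<r]), Equ (Var v) (Var v')) #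
     map (\<lambda>(i, j). (Equ (Var (es ! i)) (Var (es' ! j)),
                    Conj (Equ (Var v) (Cst i)) (Equ (Var v') (Cst j))))
       (List.product [0..<r] [0..<r])"

text \<open>The two halves mirror the two sources of tuples of \<open>S\<close>: those of
  \<open>A\<close> and those of a gadget copy. As an element may have several representatives, fresh
  ones are guessed and compared with \<open>ps\<close> by \<open>eq2\<close>.\<close>

definition rel2 :: "nat \<Rightarrow> 'r \<Rightarrow> nat \<Rightarrow> nat \<Rightarrow> 'r \<Rightarrow> srep list \<Rightarrow> 'r dnf" where
  "rel2 r R m n S ps =
     (let s = length ps in
       exAs m s (conj2 (base2 (Rel S (map Var [m..<m + s])))
         (conjs2 (map (\<lambda>i. eq2 r (ps ! i) (Inl (m + i))) [0..<s]))) @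
       exAs m r (exGs n s (conj2 (base2 (Rel R (map Var [m..<m + r])))
         (conj2 (gadget2 (Rel S (map Var [n..<n + s])))
           (conjs2 (map (\<lambda>i. eq2 r (ps ! i) (Inr ([m..<m + r], n + i))) [0..<s]))))))"

text \<open>The value at constants is a dummy: formulas of a purely relational language contain
  none.\<close>

primrec tm_srep :: "(nat \<Rightarrow> srep) \<Rightarrow> tm \<Rightarrow> srep" where
  "tm_srep \<rho> (Var x) = \<rho> x"
| "tm_srep \<rho> (Cst c) = Inl 0"

text \<open>The variables from \<open>m\<close> on in \<open>A\<close> and from \<open>n\<close> on in \<open>G\<close> are fresh.\<close>

primrec translate ::
    "nat \<Rightarrow> 'r \<Rightarrow> 'r fm \<Rightarrow> nat \<Rightarrow> nat \<Rightarrow> (nat \<Rightarrow> srep) \<Rightarrow> 'r dnf" where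
  "translate r R (Equ s t) m n \<rho> = eq2 r (tm_srep \<rho> s) (tm_srep \<rho> t)"
| "translate r R (Rel S ts) m n \<rho> = rel2 r R m n S (map (tm_srep \<rho>) ts)"
| "translate r R (Neg \<phi>) m n \<rho> = neg2 (translate r R \<phi> m n \<rho>)"
| "translate r R (Conj \<phi> \<psi>) m n \<rho> = conj2 (translate r R \<phi> m n \<rho>) (translate r R \<psi> m n \<rho>)"
| "translate r R (Exi x \<phi>) m n \<rho> =
     exA m (translate r R \<phi> (Suc m) n (\<rho>(x := Inl m))) @
     exAs m r (exG n (conj2 (base2 (Rel R (map Var [m..<m + r])))
       (translate r R \<phi> (m + r) (Suc n) (\<rho>(x := Inr ([m..<m + r], n))))))"

section \<open>Well-formedness of the translation\<close>

lemma wf2_eq2: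
  assumes "srep_ok (ar R) m n p" and "srep_ok (ar R) m n q"
  shows "wf2 (base_lang L ar R) (gadget_lang L ar R) m n (eq2 (ar R) p q)"
proof -
  have "es ! i < m" if "set es \<subseteq> {..<m}" "i < length es" for es :: "nat list" and i
    using that nth_mem by blast
  with assms show ?thesis
    by (induction "ar R" p q rule: eq2.induct)
      (auto simp: wf2_def[of _ _ _ _ "map _ _"] wf2_def[of _ _ _ _ "_ # _"]
        gadget_lang_def)
qed

lemma wf2_rel2:
  assumes "S \<in> L" and "length ps = ar S" and "\<And>p. p \<in> set ps \<Longrightarrow> srep_ok (ar R) m n p"
  shows "wf2 (base_lang L ar R) (gadget_lang L ar R) m n (rel2 (ar R) R m n S ps)"
proof -
  have ok: "srep_ok (ar R) m' n' (ps ! i)" if "m \<le> m'" "n \<le> n'" "i < ar S" for m' n' i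
    using that assms by (metis nth_mem srep_ok_mono)
  have syms: "rel_syms (base_lang L ar R) = insert R L" "arity (base_lang L ar R) = ar"
    "rel_syms (gadget_lang L ar R) = L" "arity (gadget_lang L ar R) = ar"
    by (simp_all add: base_lang_def gadget_lang_def)
  show ?thesis
    unfolding rel2_def Let_def wf2_append assms(2)
    by (intro conjI wf2_exAs wf2_exGs wf2_conj2 wf2_conjs2)
      (auto simp: assms syms intro!: wf2_eq2 ok)
qed

lemma wf2_translate:
  assumes "wf_fm (relational_lang L ar) \<phi>" and "\<And>x. srep_ok (ar R) m n (\<rho> x)"
  shows "wf2 (base_lang L ar R) (gadget_lang L ar R) m n (translate (ar R) R \<phi> m n \<rho>)"
  using assms
proof (induction \<phi> arbitrary: m n \<rho>)
  have tm: "srep_ok (ar R) m n (tm_srep \<rho> t)"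
    if "wf_tm (relational_lang L ar) t" "\<And>x. srep_ok (ar R) m n (\<rho> x)" for t m n \<rho>
    using that by (cases t) (auto simp: relational_lang_def)
  {
    case (Equ s t)
    then show ?case by (auto intro!: wf2_eq2 tm)
  next
    case (Rel S ts)
    then show ?case by (auto intro!: wf2_rel2 tm simp: relational_lang_def[of L ar])
  next
    case (Neg \<phi>)
    then show ?case by (simp add: wf2_neg2)
  next
    case (Conj \<phi> \<psi>)
    then show ?case by (simp add: wf2_conj2)
  next
    case (Exi x \<phi>)
    have "wf2 (base_lang L ar R) (gadget_lang L ar R) (Suc m) n
        (translate (ar R) R \<phi> (Suc m) n (\<rho>(x := Inl m)))"
      using Exi.prems by (intro Exi.IH) (auto intro: srep_ok_mono[of _ m n])
    moreover have "wf2 (base_lang L ar R) (gadget_lang L ar R) (m + ar R) (Suc n)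
        (translate (ar R) R \<phi> (m + ar R) (Suc n) (\<rho>(x := Inr ([m..<m + ar R], n))))"
      using Exi.prems by (intro Exi.IH) (auto intro: srep_ok_mono[of _ m n])
    ultimately show ?case
      by (auto intro!: wf2_exA wf2_exAs wf2_exG wf2_conj2 simp: base_lang_def)
  }
qed

section \<open>Correctness of the translation for a fixed base structure and gadget\<close>

locale gluing =
  fixes L :: "'r set" and ar :: "'r \<Rightarrow> nat" and R :: 'r
    and A :: "('a, 'r) struct" and G :: "('g, 'r) struct"
  assumes base: "base_structure L ar R A" and gadget: "gadget L ar R G"
begin

abbreviation "cls \<equiv> glue_class ar R A G"
abbreviation "AG \<equiv> gadget_construction ar R A G"
abbreviation "carr \<equiv> univ A <+> (rel A R \<times> univ G)"

lemma inj_roots: "inj_on (cst G) {..<ar R}"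
  using gadget by (simp add: gadget_def)

lemma rel_A_lists: "S \<in> insert R L \<Longrightarrow> as \<in> rel A S \<Longrightarrow> length as = ar S \<and> set as \<subseteq> univ A"
  using base by (auto simp: base_structure_def structure_in_def base_lang_def)

lemma rel_G_lists: "S \<in> L \<Longrightarrow> vs \<in> rel G S \<Longrightarrow> length vs = ar S \<and> set vs \<subseteq> univ G"
  using gadget by (auto simp: gadget_def structure_in_def gadget_lang_def)

lemma univ_AG: "univ AG = cls ` carr"
  by (auto simp: gadget_construction_def quotient_def glue_class_def)

text \<open>Values in \<open>carr\<close> have their tuples in \<open>rel A R\<close>;
  \<open>anchored\<close> demands this, while \<open>eq2\<close> does not test it.\<close>

lemma sat2_eq2:
  assumes "srep_ok (ar R) m n p" and "srep_ok (ar R) m n q"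
    and "srep_val \<sigma> \<tau> p \<in> carr" and "srep_val \<sigma> \<tau> q \<in> carr"
  shows "sat2 A G \<sigma> \<tau> (eq2 (ar R) p q) \<longleftrightarrow> cls (srep_val \<sigma> \<tau> p) = cls (srep_val \<sigma> \<tau> q)"
  unfolding glue_class_eq_iff[of G ar R, OF inj_roots] using assms
proof (induction "ar R" p q rule: eq2.induct)
  case (1 y z)
  then show ?case by auto
next
  case (2 y es v)
  then show ?case by (auto simp: sat2_def[of _ _ _ _ "map _ _"])
next
  case (3 es v y)
  then show ?case by (auto simp: sat2_def[of _ _ _ _ "map _ _"])
next
  case (4 es v es' v')
  have "map \<sigma> es = map \<sigma> es' \<longleftrightarrow> (\<forall>i<ar R. \<sigma> (es ! i) = \<sigma> (es' ! i))"
    using 4 by (auto simp: list_eq_iff_nth_eq)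
  moreover have "sat2 A G \<sigma> \<tau> (eq2 (ar R) (Inr (es, v)) (Inr (es', v'))) \<longleftrightarrow>
      (\<forall>i\<in>{0..<ar R}. \<sigma> (es ! i) = \<sigma> (es' ! i)) \<and> \<tau> v = \<tau> v' \<or>
      (\<exists>i\<in>{0..<ar R}. \<exists>j\<in>{0..<ar R}.
        \<sigma> (es ! i) = \<sigma> (es' ! j) \<and> \<tau> v = cst G i \<and> \<tau> v' = cst G j)"
    by (simp add: sat2_def case_prod_beta)
  ultimately have "sat2 A G \<sigma> \<tau> (eq2 (ar R) (Inr (es, v)) (Inr (es', v'))) \<longleftrightarrow>
      (map \<sigma> es = map \<sigma> es' \<and> \<tau> v = \<tau> v') \<or>
      (\<exists>i<ar R. \<exists>j<ar R. map \<sigma> es ! i = map \<sigma> es' ! j \<and> \<tau> v = cst G i \<and> \<tau> v' = cst G j)"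
    using 4 by (simp add: Bex_def Ball_def cong: conj_cong)
  also have "\<dots> \<longleftrightarrow> srep_val \<sigma> \<tau> (Inr (es, v)) = srep_val \<sigma> \<tau> (Inr (es', v')) \<or>
      (\<exists>a. anchored ar R A G (srep_val \<sigma> \<tau> (Inr (es, v))) a \<and>
           anchored ar R A G (srep_val \<sigma> \<tau> (Inr (es', v'))) a)"
  proof -
    have "map \<sigma> es \<in> rel A R" "map \<sigma> es' \<in> rel A R" using 4 by auto
    then show ?thesis by simp metis
  qed
  finally show ?case .
qed

lemma rel_AG_iff:
  "ps \<in> rel AG S \<longleftrightarrow>
     (\<exists>as \<in> rel A S. ps = map (\<lambda>a. cls (Inl a)) as) \<or>
     (\<exists>e \<in> rel A R. \<exists>vs \<in> rel G S. ps = map (\<lambda>v. cls (Inr (e, v))) vs)"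
  by (auto simp: gadget_construction_def)

lemma sat2_rel2:
  assumes S: "S \<in> L" and len: "length ps = ar S"
    and ok: "\<And>p. p \<in> set ps \<Longrightarrow> srep_ok (ar R) m n p"
    and carr: "\<And>p. p \<in> set ps \<Longrightarrow> srep_val \<sigma> \<tau> p \<in> carr"
  shows "sat2 A G \<sigma> \<tau> (rel2 (ar R) R m n S ps) \<longleftrightarrow>
    map (\<lambda>p. cls (srep_val \<sigma> \<tau> p)) ps \<in> rel AG S"
proof -
  have val: "srep_val (upds \<sigma> m as) (upds \<tau> n vs) (ps ! i) = srep_val \<sigma> \<tau> (ps ! i)"
    if "i < ar S" for i as vs
    using that ok len by (intro srep_val_cong[of "ar R" m n]) (auto simp: upds_less)
  have ok': "srep_ok (ar R) m' n' (ps ! i)" if "m \<le> m'" "n \<le> n'" "i < ar S" for m' n' i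
    using that ok len by (metis nth_mem srep_ok_mono)
  have carr': "srep_val \<sigma> \<tau> (ps ! i) \<in> carr" if "i < ar S" for i
    using that carr len by simp
  have eqA: "sat2 A G (upds \<sigma> m as) \<tau> (eq2 (ar R) (ps ! i) (Inl (m + i))) \<longleftrightarrow>
      cls (srep_val \<sigma> \<tau> (ps ! i)) = cls (Inl (as ! i))"
    if "i < ar S" "length as = ar S" "set as \<subseteq> univ A" for i as
  proof -
    have "as ! i \<in> univ A" using that by (auto simp: subset_iff)
    \<comment> \<open>The empty list leaves \<open>\<tau>\<close> unchanged: only variables of
      \<open>A\<close> are new here.\<close>
    then show ?thesis
      using that val[of i as "[]"] carr'[of i] ok'[of "m + ar S" n i]
      by (subst sat2_eq2[of "m + ar S" n]) (auto simp: upds_nth)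
  qed
  have eqG: "sat2 A G (upds \<sigma> m e) (upds \<tau> n vs) (eq2 (ar R) (ps ! i) (Inr ([m..<m + ar R], n + i)))
      \<longleftrightarrow> cls (srep_val \<sigma> \<tau> (ps ! i)) = cls (Inr (e, vs ! i))"
    if "i < ar S" "length vs = ar S" "set vs \<subseteq> univ G" "length e = ar R" "e \<in> rel A R" for i vs e
  proof -
    have "vs ! i \<in> univ G" using that by (auto simp: subset_iff)
    then show ?thesis
      using that val[of i e vs] carr'[of i] ok'[of "m + ar R" "n + ar S" i]
      by (subst sat2_eq2[of "m + ar R" "n + ar S"]) (auto simp: upds_nth map_upds_upt)
  qed
  have fromA: "sat2 A G \<sigma> \<tau> (exAs m (ar S) (conj2 (base2 (Rel S (map Var [m..<m + ar S])))
         (conjs2 (map (\<lambda>i. eq2 (ar R) (ps ! i) (Inl (m + i))) [0..<ar S])))) \<longleftrightarrow>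
      (\<exists>as \<in> rel A S. map (\<lambda>p. cls (srep_val \<sigma> \<tau> p)) ps = map (\<lambda>a. cls (Inl a)) as)"
    (is "sat2 A G \<sigma> \<tau> (exAs m (ar S) ?D) \<longleftrightarrow> _")
  proof -
    have "sat2 A G (upds \<sigma> m as) \<tau> ?D \<longleftrightarrow>
        as \<in> rel A S \<and> map (\<lambda>p. cls (srep_val \<sigma> \<tau> p)) ps = map (\<lambda>a. cls (Inl a)) as"
      if "length as = ar S" "set as \<subseteq> univ A" for as
      using map_upds_upt[of "ar S" as \<sigma> m] that len
      by (auto simp: comp_def eqA map_eq_map_iff[of _ ps] simp del: upt.simps)
    \<comment> \<open>The quantifiers range over lists of length \<open>ar S\<close> in the
      universe, and every tuple of the relation is such a list.\<close>
    then show ?thesis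
      using rel_A_lists[of S] S unfolding sat2_exAs by blast
  qed
  have fromG: "sat2 A G \<sigma> \<tau> (exAs m (ar R) (exGs n (ar S)
         (conj2 (base2 (Rel R (map Var [m..<m + ar R])))
         (conj2 (gadget2 (Rel S (map Var [n..<n + ar S])))
           (conjs2 (map (\<lambda>i. eq2 (ar R) (ps ! i) (Inr ([m..<m + ar R], n + i))) [0..<ar S])))))) \<longleftrightarrow>
      (\<exists>e \<in> rel A R. \<exists>vs \<in> rel G S.
        map (\<lambda>p. cls (srep_val \<sigma> \<tau> p)) ps = map (\<lambda>v. cls (Inr (e, v))) vs)"
    (is "sat2 A G \<sigma> \<tau> (exAs m (ar R) (exGs n (ar S) ?D)) \<longleftrightarrow> _")
  proof -
    have "sat2 A G (upds \<sigma> m e) (upds \<tau> n vs) ?D \<longleftrightarrow> e \<in> rel A R \<and> vs \<in> rel G S \<and>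
        map (\<lambda>p. cls (srep_val \<sigma> \<tau> p)) ps = map (\<lambda>v. cls (Inr (e, v))) vs"
      if "length e = ar R" "length vs = ar S" "set vs \<subseteq> univ G" for e vs
      using map_upds_upt[of "ar R" e \<sigma> m] map_upds_upt[of "ar S" vs \<tau> n] that len
      \<comment> \<open>\<open>eqG\<close> speaks of \<open>e \<in> rel A R\<close> only; for other
        \<open>e\<close> both sides are false.\<close>
      by (cases "e \<in> rel A R")
        (auto simp: comp_def eqG map_eq_map_iff[of _ ps] simp del: upt.simps)
    then show ?thesis
      using rel_A_lists[of R] rel_G_lists[of S] S unfolding sat2_exAs sat2_exGs by blast
  qed
  show ?thesis
    unfolding rel2_def Let_def len sat2_append fromA fromG rel_AG_iff ..
qed

text \<open>Induction on \<open>\<phi>\<close>, with bounds, representatives and assignments kept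
  general. A quantifier over classes is one over representatives, and the two kinds of these give
  the two disjuncts of the translated quantifier.\<close>

lemma sat2_translate:
  assumes "wf_fm (relational_lang L ar) \<phi>" and "\<And>x. srep_ok (ar R) m n (\<rho> x)"
    and "\<And>x. srep_val \<sigma> \<tau> (\<rho> x) \<in> carr"
  shows "sat2 A G \<sigma> \<tau> (translate (ar R) R \<phi> m n \<rho>) \<longleftrightarrow>
    sat AG (\<lambda>x. cls (srep_val \<sigma> \<tau> (\<rho> x))) \<phi>"
  using assms
proof (induction \<phi> arbitrary: m n \<rho> \<sigma> \<tau>)
  have tm: "\<exists>x. t = Var x" if "wf_tm (relational_lang L ar) t" for t
    using that by (cases t) (auto simp: relational_lang_def)
  {
    case (Equ s t)
    then obtain x y where "s = Var x" "t = Var y" using tm by fastforce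
    with Equ show ?case by (simp add: sat2_eq2[of m n])
  next
    case (Rel S ts)
    then have "S \<in> L" "length ts = ar S" by (auto simp: relational_lang_def)
    have v: "\<exists>x. t = Var x" if "t \<in> set ts" for t using Rel.prems(1) tm that by simp
    have vals: "map (\<lambda>p. cls (srep_val \<sigma> \<tau> p)) (map (tm_srep \<rho>) ts) =
        map (tm_val AG (\<lambda>x. cls (srep_val \<sigma> \<tau> (\<rho> x)))) ts"
      using v by fastforce
    have "srep_ok (ar R) m n p \<and> srep_val \<sigma> \<tau> p \<in> carr"
      if "p \<in> set (map (tm_srep \<rho>) ts)" for p
      using that v Rel.prems(2,3) by fastforce
    then have "sat2 A G \<sigma> \<tau> (rel2 (ar R) R m n S (map (tm_srep \<rho>) ts)) \<longleftrightarrow>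
        map (\<lambda>p. cls (srep_val \<sigma> \<tau> p)) (map (tm_srep \<rho>) ts) \<in> rel AG S"
      using \<open>S \<in> L\<close> \<open>length ts = ar S\<close> by (intro sat2_rel2) auto
    then show ?case by (simp only: translate.simps sat.simps vals)
  next
    case (Neg \<phi>)
    then show ?case by simp
  next
    case (Conj \<phi> \<psi>)
    then show ?case by simp
  next
    case (Exi x \<phi>)
    let ?s = "\<lambda>\<sigma> \<tau> \<rho> x. cls (srep_val \<sigma> \<tau> (\<rho> x))"
    let ?es = "[m..<m + ar R]"
    \<comment> \<open>A witness represented by a vertex of \<open>A\<close> is stored in the fresh
      variable \<open>m\<close>.\<close>
    have A: "sat2 A G (\<sigma>(m := a)) \<tau> (translate (ar R) R \<phi> (Suc m) n (\<rho>(x := Inl m))) \<longleftrightarrow>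
        sat AG ((?s \<sigma> \<tau> \<rho>)(x := cls (Inl a))) \<phi>" if a: "a \<in> univ A" for a
    proof -
      have val: "srep_val (\<sigma>(m := a)) \<tau> (\<rho> y) = srep_val \<sigma> \<tau> (\<rho> y)" for y
        using Exi.prems(2) by (intro srep_val_cong[of "ar R" m n]) auto
      have eq: "?s (\<sigma>(m := a)) \<tau> (\<rho>(x := Inl m)) = (?s \<sigma> \<tau> \<rho>)(x := cls (Inl a))"
        by (rule ext) (simp add: val)
      have ok: "srep_ok (ar R) (Suc m) n ((\<rho>(x := Inl m)) y)" for y
        using Exi.prems(2) by (auto intro: srep_ok_mono[of _ m n])
      have carr: "srep_val (\<sigma>(m := a)) \<tau> ((\<rho>(x := Inl m)) y) \<in> carr" for y
        using Exi.prems(3)[of y] a by (auto simp: val)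
      have "wf_fm (relational_lang L ar) \<phi>" using Exi.prems(1) by simp
      from Exi.IH[of _ _ "\<rho>(x := Inl m)", OF this ok carr] show ?thesis unfolding eq .
    qed
    \<comment> \<open>A witness inside a gadget copy takes \<open>ar R\<close> fresh variables of
      \<open>A\<close> for \<open>e\<close> and one of \<open>G\<close> for
      \<open>v\<close>.\<close>
    have G: "sat2 A G (upds \<sigma> m e) (\<tau>(n := v))
          (translate (ar R) R \<phi> (m + ar R) (Suc n) (\<rho>(x := Inr (?es, n)))) \<longleftrightarrow>
        sat AG ((?s \<sigma> \<tau> \<rho>)(x := cls (Inr (e, v)))) \<phi>" if e: "e \<in> rel A R" and v: "v \<in> univ G" for e v
    proof -
      have len: "length e = ar R" using rel_A_lists e by simp
      have val: "srep_val (upds \<sigma> m e) (\<tau>(n := v)) (\<rho> y) = srep_val \<sigma> \<tau> (\<rho> y)" for y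
        using Exi.prems(2) by (intro srep_val_cong[of "ar R" m n]) (auto simp: upds_less)
      have new: "srep_val (upds \<sigma> m e) (\<tau>(n := v)) (Inr (?es, n)) = Inr (e, v)"
        using len by (simp add: map_upds_upt)
      have eq: "?s (upds \<sigma> m e) (\<tau>(n := v)) (\<rho>(x := Inr (?es, n))) =
          (?s \<sigma> \<tau> \<rho>)(x := cls (Inr (e, v)))"
        using val new by (intro ext) (simp del: srep_val_simps)
      have ok: "srep_ok (ar R) (m + ar R) (Suc n) ((\<rho>(x := Inr (?es, n))) y)" for y
        using Exi.prems(2) by (auto intro: srep_ok_mono[of _ m n])
      have carr: "srep_val (upds \<sigma> m e) (\<tau>(n := v)) ((\<rho>(x := Inr (?es, n))) y) \<in> carr" for y
        using Exi.prems(3)[of y] e v val new by (cases "y = x") (auto simp del: srep_val_simps)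
      have "wf_fm (relational_lang L ar) \<phi>" using Exi.prems(1) by simp
      from Exi.IH[of _ _ "\<rho>(x := Inr (?es, n))", OF this ok carr] show ?thesis unfolding eq .
    qed
    have R: "sat A (upds \<sigma> m e) (Rel R (map Var ?es)) \<longleftrightarrow> e \<in> rel A R" if "length e = ar R" for e
      using map_upds_upt[of "ar R" e \<sigma> m] that by (simp add: comp_def)
    have "sat2 A G \<sigma> \<tau> (translate (ar R) R (Exi x \<phi>) m n \<rho>) \<longleftrightarrow>
        (\<exists>a \<in> univ A. sat AG ((?s \<sigma> \<tau> \<rho>)(x := cls (Inl a))) \<phi>) \<or>
        (\<exists>e \<in> rel A R. \<exists>v \<in> univ G. sat AG ((?s \<sigma> \<tau> \<rho>)(x := cls (Inr (e, v)))) \<phi>)"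
      unfolding translate.simps sat2_append sat2_exA sat2_exAs sat2_exG sat2_conj2 sat2_base2
      using A G R rel_A_lists[of R] by blast
    also have "\<dots> \<longleftrightarrow> sat AG (?s \<sigma> \<tau> \<rho>) (Exi x \<phi>)"
      by (auto simp: univ_AG Plus_def)
    finally show ?case .
  }
qed

end

text \<open>Initially every variable is represented by the vertex stored in variable 0 of
  \<open>A\<close>. The outer quantifier binds that variable, which makes the components
  sentences.\<close>

definition decomposition :: "nat \<Rightarrow> 'r \<Rightarrow> 'r fm \<Rightarrow> 'r dnf" where
  "decomposition r R \<phi> = exA 0 (translate r R \<phi> 1 0 (\<lambda>_. Inl 0))"

lemma sentence_decomposition:
  assumes "sentence (relational_lang L ar) \<phi>" and "(\<alpha>, \<beta>) \<in> set (decomposition (ar R) R \<phi>)"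
  shows "sentence (base_lang L ar R) \<alpha>" and "sentence (gadget_lang L ar R) \<beta>"
proof -
  have "wf2 (base_lang L ar R) (gadget_lang L ar R) 0 0 (decomposition (ar R) R \<phi>)"
    using assms(1) unfolding decomposition_def sentence_def
    by (auto intro!: wf2_exA wf2_translate)
  with assms(2) show "sentence (base_lang L ar R) \<alpha>" "sentence (gadget_lang L ar R) \<beta>"
    by (auto simp: wf2_def sentence_def)
qed

text \<open>A composition theorem of Feferman-Vaught type. The list of pairs depends on
  \<open>\<phi>\<close>, \<open>R\<close> and \<open>ar R\<close> but not on \<open>A\<close> and
  \<open>G\<close>, so one finite list serves all members of the sequences and their limits.\<close>

theorem models_gadget_construction_iff:
  assumes "base_structure L ar R A" and "gadget L ar R G" and \<phi>: "sentence (relational_lang L ar) \<phi>"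
  shows "gadget_construction ar R A G \<Turnstile> \<phi> \<longleftrightarrow>
    (\<exists>(\<alpha>, \<beta>) \<in> set (decomposition (ar R) R \<phi>). A \<Turnstile> \<alpha> \<and> G \<Turnstile> \<beta>)"
proof -
  interpret gluing L ar R A G using assms by unfold_locales
  obtain a v where av: "a \<in> univ A" "v \<in> univ G"
    using base gadget by (auto simp: base_structure_def gadget_def structure_in_def)
  have "sat2 A G (\<lambda>_. a) (\<lambda>_. v) (decomposition (ar R) R \<phi>) \<longleftrightarrow>
      (\<exists>b \<in> univ A. sat AG (\<lambda>_. cls (Inl b)) \<phi>)"
    using \<phi> by (simp add: decomposition_def sentence_def sat2_translate InlI)
  also have "\<dots> \<longleftrightarrow> AG \<Turnstile> \<phi>"
  proof -
    \<comment> \<open>Since \<open>\<phi>\<close> is a sentence, its truth is the same for every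
      \<open>b\<close>, and \<open>A\<close> has a vertex.\<close>
    have "sat AG (\<lambda>_. cls (Inl b)) \<phi> \<longleftrightarrow> AG \<Turnstile> \<phi>" if "b \<in> univ A" for b
      using \<phi> that models_iff_sat[of \<phi> "\<lambda>_. cls (Inl b)" AG]
      by (auto simp: sentence_def univ_AG)
    with av show ?thesis by auto
  qed
  finally have "AG \<Turnstile> \<phi> \<longleftrightarrow> sat2 A G (\<lambda>_. a) (\<lambda>_. v) (decomposition (ar R) R \<phi>)" ..
  moreover have "sat A (\<lambda>_. a) (fst d) \<longleftrightarrow> A \<Turnstile> fst d" "sat G (\<lambda>_. v) (snd d) \<longleftrightarrow> G \<Turnstile> snd d"
    if "d \<in> set (decomposition (ar R) R \<phi>)" for d
    using sentence_decomposition[of L ar \<phi> "fst d" "snd d" R, OF \<phi>] that av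
      models_iff_sat[of "fst d" "\<lambda>_. a" A] models_iff_sat[of "snd d" "\<lambda>_. v" G]
    by (auto simp: sentence_def)
  ultimately show ?thesis
    by (simp add: sat2_def case_prod_beta cong: bex_cong)
qed

section \<open>Limits\<close>

lemma elem_convergent_cases:
  assumes "elem_convergent \<L> M" and "sentence \<L> \<phi>"
  shows "(\<forall>\<^sub>\<infinity>n. M n \<Turnstile> \<phi>) \<or> (\<forall>\<^sub>\<infinity>n. \<not> M n \<Turnstile> \<phi>)"
proof -
  have "M n \<Turnstile> Neg \<phi> \<longleftrightarrow> \<not> M n \<Turnstile> \<phi>" for n
    using assms by (intro models_Neg) (auto simp: elem_convergent_def sentence_def structure_in_def)
  moreover have "(\<forall>\<^sub>\<infinity>n. M n \<Turnstile> \<phi>) \<or> (\<forall>\<^sub>\<infinity>n. M n \<Turnstile> Neg \<phi>)"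
    using assms unfolding elem_convergent_def by blast
  ultimately show ?thesis by (simp only:)
qed

text \<open>If no member of \<open>D\<close> holds eventually, each fails eventually, and by
  finiteness all fail from a common index on.\<close>

lemma eventually_ex_finite:
  assumes "finite D" and "\<And>d. d \<in> D \<Longrightarrow> (\<forall>\<^sub>\<infinity>n. P d n) \<or> (\<forall>\<^sub>\<infinity>n. \<not> P d n)"
  shows "(\<exists>d \<in> D. \<forall>\<^sub>\<infinity>n. P d n) \<or> (\<forall>\<^sub>\<infinity>n. \<forall>d \<in> D. \<not> P d n)"
proof (cases "\<exists>d \<in> D. \<forall>\<^sub>\<infinity>n. P d n")
  case False
  then have "\<forall>d \<in> D. \<forall>\<^sub>\<infinity>n. \<not> P d n" using assms(2) by blast
  with assms(1) have "\<forall>\<^sub>\<infinity>n. \<forall>d \<in> D. \<not> P d n" by (rule eventually_ball_finite)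
  then show ?thesis ..
qed simp

text \<open>That two roots differ is a sentence of the gadget language, so it passes to the
  limit.\<close>

lemma elem_limit_gadget:
  assumes "\<forall>n. gadget L ar R (G n)" and "elem_limit (gadget_lang L ar R) G G'"
  shows "gadget L ar R G'"
proof -
  have "cst G' i \<noteq> cst G' j" if ij: "i < ar R" "j < ar R" "i \<noteq> j" for i j
  proof -
    let ?\<phi> = "Neg (Equ (Cst i) (Cst j))"
    have "G n \<Turnstile> ?\<phi>" for n
      using assms(1) ij by (auto simp: models_def gadget_def inj_on_def)
    moreover have "sentence (gadget_lang L ar R) ?\<phi>"
      using ij by (simp add: sentence_def gadget_lang_def)
    ultimately have "G' \<Turnstile> ?\<phi>"
      using assms(2) by (simp add: elem_limit_def)
    moreover obtain v where "v \<in> univ G'"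
      using assms(2) by (auto simp: elem_limit_def structure_in_def)
    ultimately show ?thesis
      by (auto simp: models_iff_sat[of _ "\<lambda>_. v"])
  qed
  with assms(2) show ?thesis
    by (auto simp: gadget_def elem_limit_def inj_on_def)
qed

theorem corollary3p2:
  fixes L :: "'r set" and ar :: "'r \<Rightarrow> nat" and R :: 'r
    and A :: "nat \<Rightarrow> ('a, 'r) struct"
    and G :: "nat \<Rightarrow> ('g, 'r) struct"
  assumes "\<forall>S \<in> L. ar S \<ge> 1"
    and "R \<notin> L"
    and "ar R \<ge> 1"
    and "\<forall>n. base_structure L ar R (A n)"
    and "\<forall>n. gadget L ar R (G n)"
    and "elem_convergent (base_lang L ar R) A"
    and "elem_convergent (gadget_lang L ar R) G"
  shows "elem_convergent (relational_lang L ar) (\<lambda>n. gadget_construction ar R (A n) (G n)) \<and>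
    (\<forall>(A' :: ('b, 'r) struct) (G' :: ('h, 'r) struct) (N :: ('c, 'r) struct).
       elem_limit (base_lang L ar R) A A' \<longrightarrow>
       elem_limit (gadget_lang L ar R) G G' \<longrightarrow>
       elem_limit (relational_lang L ar) (\<lambda>n. gadget_construction ar R (A n) (G n)) N \<longrightarrow>
       elem_equiv (relational_lang L ar) N (gadget_construction ar R A' G'))"
proof -
  let ?AG = "\<lambda>n. gadget_construction ar R (A n) (G n)"
  let ?D = "\<lambda>\<phi>. set (decomposition (ar R) R \<phi>)"
  have AG_iff: "?AG n \<Turnstile> \<phi> \<longleftrightarrow> (\<exists>(\<alpha>, \<beta>) \<in> ?D \<phi>. A n \<Turnstile> \<alpha> \<and> G n \<Turnstile> \<beta>)"
    if "sentence (relational_lang L ar) \<phi>" for \<phi> n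
    by (rule models_gadget_construction_iff[OF assms(4)[rule_format] assms(5)[rule_format] that])
  have alternative: "(\<exists>(\<alpha>, \<beta>) \<in> ?D \<phi>. (\<forall>\<^sub>\<infinity>n. A n \<Turnstile> \<alpha>) \<and> (\<forall>\<^sub>\<infinity>n. G n \<Turnstile> \<beta>)) \<or> (\<forall>\<^sub>\<infinity>n. \<not> ?AG n \<Turnstile> \<phi>)"
    if \<phi>: "sentence (relational_lang L ar) \<phi>" for \<phi>
  proof -
    \<comment> \<open>Either both components of a pair hold eventually, or one fails eventually and
      the conjunction fails with it.\<close>
    have "(\<forall>\<^sub>\<infinity>n. A n \<Turnstile> fst d \<and> G n \<Turnstile> snd d) \<or> (\<forall>\<^sub>\<infinity>n. \<not> (A n \<Turnstile> fst d \<and> G n \<Turnstile> snd d))"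
      if "d \<in> ?D \<phi>" for d
    proof -
      have "sentence (base_lang L ar R) (fst d)" "sentence (gadget_lang L ar R) (snd d)"
        using sentence_decomposition[of L ar \<phi> "fst d" "snd d" R, OF \<phi>] that by auto
      from elem_convergent_cases[OF assms(6) this(1)] elem_convergent_cases[OF assms(7) this(2)]
      consider "\<forall>\<^sub>\<infinity>n. A n \<Turnstile> fst d" "\<forall>\<^sub>\<infinity>n. G n \<Turnstile> snd d"
        | "\<forall>\<^sub>\<infinity>n. \<not> A n \<Turnstile> fst d" | "\<forall>\<^sub>\<infinity>n. \<not> G n \<Turnstile> snd d"
        by blast
      then show ?thesis
      proof cases
        case 1
        then show ?thesis by (simp add: eventually_conj)
      next
        case 2
        then have "\<forall>\<^sub>\<infinity>n. \<not> (A n \<Turnstile> fst d \<and> G n \<Turnstile> snd d)" by (rule eventually_mono) simp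
        then show ?thesis ..
      next
        case 3
        then have "\<forall>\<^sub>\<infinity>n. \<not> (A n \<Turnstile> fst d \<and> G n \<Turnstile> snd d)" by (rule eventually_mono) simp
        then show ?thesis ..
      qed
    qed
    from eventually_ex_finite[of "?D \<phi>" "\<lambda>d n. A n \<Turnstile> fst d \<and> G n \<Turnstile> snd d", OF _ this] show ?thesis
      unfolding AG_iff[OF \<phi>] by (simp add: eventually_conj_iff case_prod_beta)
  qed
  have holds: "\<forall>\<^sub>\<infinity>n. ?AG n \<Turnstile> \<phi>"
    if \<phi>: "sentence (relational_lang L ar) \<phi>"
      and "\<exists>(\<alpha>, \<beta>) \<in> ?D \<phi>. (\<forall>\<^sub>\<infinity>n. A n \<Turnstile> \<alpha>) \<and> (\<forall>\<^sub>\<infinity>n. G n \<Turnstile> \<beta>)" for \<phi>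
  proof -
    from that(2) obtain \<alpha> \<beta> where D: "(\<alpha>, \<beta>) \<in> ?D \<phi>" and "\<forall>\<^sub>\<infinity>n. A n \<Turnstile> \<alpha>" "\<forall>\<^sub>\<infinity>n. G n \<Turnstile> \<beta>" by auto
    from this(2,3) have "\<forall>\<^sub>\<infinity>n. A n \<Turnstile> \<alpha> \<and> G n \<Turnstile> \<beta>" by (rule eventually_conj)
    then show ?thesis
      unfolding AG_iff[OF \<phi>] by (rule eventually_mono) (use D in blast)
  qed
  have struct: "structure_in (relational_lang L ar) (?AG n)" for n
    by (rule structure_in_gadget_construction[OF assms(4)[rule_format] assms(5)[rule_format]])
  have Neg: "?AG n \<Turnstile> Neg \<phi> \<longleftrightarrow> \<not> ?AG n \<Turnstile> \<phi>" if "sentence (relational_lang L ar) \<phi>" for n \<phi>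
    using that struct[of n] by (intro models_Neg) (auto simp: sentence_def structure_in_def)
  have "elem_convergent (relational_lang L ar) ?AG"
    unfolding elem_convergent_def
  proof (intro conjI allI impI struct)
    fix \<phi> assume \<phi>: "sentence (relational_lang L ar) \<phi>"
    show "(\<forall>\<^sub>\<infinity>n. ?AG n \<Turnstile> \<phi>) \<or> (\<forall>\<^sub>\<infinity>n. ?AG n \<Turnstile> Neg \<phi>)"
      unfolding Neg[OF \<phi>] using alternative[OF \<phi>] holds[OF \<phi>] by blast
  qed
  moreover have "N \<Turnstile> \<phi> \<longleftrightarrow> gadget_construction ar R A' G' \<Turnstile> \<phi>"
    if A': "elem_limit (base_lang L ar R) A A'" and G': "elem_limit (gadget_lang L ar R) G G'"
      and N: "elem_limit (relational_lang L ar) ?AG N"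
      and \<phi>: "sentence (relational_lang L ar) \<phi>"
    for A' :: "('b, 'r) struct" and G' :: "('h, 'r) struct" and N :: "('c, 'r) struct" and \<phi>
  proof -
    \<comment> \<open>The limits are again a base structure and a gadget, so the same pairs decide
      \<open>\<phi>\<close> in the construction on the limits.\<close>
    have "gadget_construction ar R A' G' \<Turnstile> \<phi> \<longleftrightarrow> (\<exists>(\<alpha>, \<beta>) \<in> ?D \<phi>. A' \<Turnstile> \<alpha> \<and> G' \<Turnstile> \<beta>)"
      using A' elem_limit_gadget[of L ar R, OF assms(5) G'] \<phi>
        models_gadget_construction_iff[of L ar R A' G' \<phi>]
      unfolding base_structure_def elem_limit_def by blast
    also have "\<dots> \<longleftrightarrow> (\<exists>(\<alpha>, \<beta>) \<in> ?D \<phi>. (\<forall>\<^sub>\<infinity>n. A n \<Turnstile> \<alpha>) \<and> (\<forall>\<^sub>\<infinity>n. G n \<Turnstile> \<beta>))"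
      using A' G' sentence_decomposition[of L ar \<phi> _ _ R, OF \<phi>]
      unfolding elem_limit_def by blast
    also have "\<dots> \<longleftrightarrow> (\<forall>\<^sub>\<infinity>n. ?AG n \<Turnstile> \<phi>)"
    proof -
      \<comment> \<open>Two complementary sets of indices cannot both be cofinite.\<close>
      have False if "\<forall>\<^sub>\<infinity>n. ?AG n \<Turnstile> \<phi>" "\<forall>\<^sub>\<infinity>n. \<not> ?AG n \<Turnstile> \<phi>"
        using eventually_conj[OF that] by simp
      then show ?thesis using alternative[OF \<phi>] holds[OF \<phi>] by blast
    qed
    finally show ?thesis using N \<phi> by (simp add: elem_limit_def)
  qed
  ultimately show ?thesis by (simp add: elem_equiv_def)
qed

end
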